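(* Let $k\geq 3$ be an integer and let $A$ be a finite set of $k$ positive integers such that $$|k\hat{}_{\underline{+}}A|=\binom{k+1}{2}+1.$$ Then: (i) if $k=3$, $A=\{a_0,a_1,a_0+a_1\}$ for some positive integers $a_0<a_1$; (ii) if $k\geq 4$, $A=d*[1,k]$ for some positive integer $d$.
   Context: For a finite set $A=\{a_0,a_1,\ldots,a_{k-1}\}$ of $k$ distinct integers and an integer $1\leq h\leq k$, the $h$-fold restricted signed sumset of $A$ is $$h\hat{}_{\underline{+}}A:=\Big\{\sum_{i=0}^{k-1}\lambda_i a_i : (\lambda_0,\ldots,\lambda_{k-1})\in\{-1,0,1\}^k,\ \sum_{i=0}^{k-1}|\lambda_i|=h\Big\}.$$ Here it is used with $h=k$. $|S|$ denotes the cardinality of a finite set $S$. For integers $a\leq b$, $[a,b]=\{n\in\mathbb{Z}: a\leq n\leq b\}$. For an integer $d$ and a set $S$ of integers, $d*S=\{d\cdot s : s\in S\}$ is the $d$-dilation of $S$. *)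

theory Defs
  imports Complex_Main
begin

(* The coefficient vector (lambda_0, ..., lambda_(k-1)) is indexed by the elements of A
   themselves, as these are distinct; only the values of l on A matter.
   Meant for finite A: the sums below are 0 by convention when A is infinite. *)
definition restricted_signed_sumset :: "nat \<Rightarrow> int set \<Rightarrow> int set" where
  "restricted_signed_sumset h A =
     {(\<Sum>a\<in>A. l a * a) | l :: int \<Rightarrow> int.
        (\<forall>a\<in>A. l a \<in> {-1, 0, 1}) \<and> (\<Sum>a\<in>A. \<bar>l a\<bar>) = int h}"

definition dilation :: "int \<Rightarrow> int set \<Rightarrow> int set" where
  "dilation d S = {d * s | s. s \<in> S}"

end

theory Submission
  imports Defs
begin

text \<open>
  Choosing signs for all elements of \<open>A\<close> amounts to choosing the subset \<open>B\<close> that gets the sign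
  plus, and the signed sum is then \<open>2 * \<Sum>B - \<Sum>A\<close>. So the theorem is about sets of positive
  integers with the least possible number of subset sums.

  Let \<open>b\<close> exceed every element of a set \<open>A'\<close> of positive integers, let \<open>A = A' \<union> {b}\<close>, and write \<open>\<sigma>\<close> for the sum of \<open>A\<close>.
  The numbers \<open>\<sigma> - j\<close> with \<open>j = 0\<close> or \<open>j \<in> A'\<close> are subset sums of \<open>A\<close> that exceed \<open>\<sigma> - b\<close>, the
  largest subset sum of \<open>A'\<close>. Hence \<open>A\<close> has at least \<open>card A' + 1\<close> more subset sums than \<open>A'\<close>, and
  induction gives the lower bound \<open>((k + 1) choose 2) + 1\<close>. If \<open>A\<close> attains the bound, then so does
  \<open>A'\<close>, and \<open>A\<close> has no further subset sums; reflecting by \<open>x \<mapsto> \<sigma> - x\<close>, every subset sum \<open>x\<close> of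
  \<open>A'\<close> outside \<open>A' \<union> {0}\<close> has \<open>\<sigma> - x\<close> among the subset sums of \<open>A'\<close>
  (\<open>minimal_subset_sums_insert_max\<close>).

  One or two well-chosen \<open>x\<close> then determine \<open>b\<close> at each size. For \<open>A' = {p, q}\<close>, \<open>x = p + q\<close>
  forces \<open>b = p + q\<close>. For \<open>A' = {p, q, p + q}\<close> with \<open>p < q\<close>, \<open>x = 2 * p + q\<close> forces
  \<open>b = 2 * p + q\<close> and then \<open>x = p + 2 * q\<close> forces \<open>q = 2 * p\<close>, so that \<open>A\<close> is the progression
  \<open>p, 2 * p, 3 * p, 4 * p\<close>. From there on \<open>A' = d * [1, n]\<close>, and \<open>x = d * (n + 1)\<close> forces
  \<open>b = x\<close>: the number \<open>\<sigma> - x = \<Sum>A' + (b - x)\<close> is a subset sum of \<open>A'\<close>, so it is at most \<open>\<Sum>A'\<close>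
  and divisible by \<open>d\<close>, which makes \<open>b\<close> a multiple of \<open>d\<close> with \<open>d * n < b \<le> d * (n + 1)\<close>.
\<close>

section \<open>Subset sums and signed sums\<close>

definition subset_sums :: "int set \<Rightarrow> int set" where
  "subset_sums A = \<Sum> ` Pow A"

lemma finite_subset_sums: "finite A \<Longrightarrow> finite (subset_sums A)"
  by (simp add: subset_sums_def)

lemma sum_in_subset_sums: "B \<subseteq> A \<Longrightarrow> \<Sum>B \<in> subset_sums A"
  by (auto simp: subset_sums_def)

lemma subset_sums_empty: "subset_sums {} = {0}"
  by (simp add: subset_sums_def)

lemma subset_sums_insert:
  assumes "finite A" "b \<notin> A"
  shows "subset_sums (insert b A) = subset_sums A \<union> (\<lambda>s. b + s) ` subset_sums A"
proof -
  have "\<Sum>(insert b B) = b + \<Sum>B" if "B \<subseteq> A" for B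
    using that assms by (subst sum.insert) (auto intro: finite_subset)
  then show ?thesis
    by (auto simp: subset_sums_def Pow_insert image_Un image_image)
qed

lemma subset_sums_le_sum:
  assumes "finite A" "\<forall>a\<in>A. a > 0" "s \<in> subset_sums A"
  shows "s \<le> \<Sum>A"
  using assms by (auto simp: subset_sums_def intro!: sum_mono2 intro: less_imp_le)

lemma subset_sums_reflect:
  assumes "finite A" "s \<in> subset_sums A"
  shows "\<Sum>A - s \<in> subset_sums A"
proof -
  obtain B where B: "B \<subseteq> A" "s = \<Sum>B"
    using assms(2) by (auto simp: subset_sums_def)
  then have "\<Sum>A - s = \<Sum>(A - B)"
    using assms(1) by (simp add: sum_diff)
  then show ?thesis
    by (simp add: sum_in_subset_sums)
qed

lemma subset_sums_dvd:
  assumes "\<forall>a\<in>A. d dvd a" "s \<in> subset_sums A"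
  shows "d dvd s"
  using assms by (auto simp: subset_sums_def intro!: dvd_sum)

text \<open>All \<open>card A\<close> coefficients are nonzero here, so they are signs, and the set of elements with
  coefficient 1 encodes them.\<close>

lemma restricted_signed_sumset_card_self:
  assumes "finite A"
  shows "restricted_signed_sumset (card A) A = (\<lambda>s. 2 * s - \<Sum>A) ` subset_sums A"
proof (intro equalityI subsetI)
  fix x assume "x \<in> restricted_signed_sumset (card A) A"
  then obtain l :: "int \<Rightarrow> int" where l: "\<forall>a\<in>A. l a \<in> {-1, 0, 1}"
    "(\<Sum>a\<in>A. \<bar>l a\<bar>) = int (card A)" and x: "x = (\<Sum>a\<in>A. l a * a)"
    by (auto simp: restricted_signed_sumset_def)
  have le1: "0 \<le> 1 - \<bar>l a\<bar>" if "a \<in> A" for a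
    using l(1) that by auto
  have "(\<Sum>a\<in>A. 1 - \<bar>l a\<bar>) = 0"
    using l(2) by (simp add: sum_subtractf)
  then have "\<forall>a\<in>A. 1 - \<bar>l a\<bar> = 0"
    using assms le1 by (subst (asm) sum_nonneg_eq_0_iff) auto
  then have signs: "l a = 1 \<or> l a = -1" if "a \<in> A" for a
    using that by fastforce
  define B where "B = {a \<in> A. l a = 1}"
  have "x = (\<Sum>a\<in>A. 2 * (if l a = 1 then a else 0) - a)"
    unfolding x using signs by (intro sum.cong) fastforce+
  also have "\<dots> = 2 * \<Sum>B - \<Sum>A"
    by (simp add: sum_subtractf B_def sum.inter_filter assms flip: sum_distrib_left)
  finally show "x \<in> (\<lambda>s. 2 * s - \<Sum>A) ` subset_sums A"
    using sum_in_subset_sums[of B A] by (auto simp: B_def)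
next
  fix x assume "x \<in> (\<lambda>s. 2 * s - \<Sum>A) ` subset_sums A"
  then obtain B where B: "B \<subseteq> A" and x: "x = 2 * \<Sum>B - \<Sum>A"
    by (auto simp: subset_sums_def)
  define l :: "int \<Rightarrow> int" where "l a = (if a \<in> B then 1 else -1)" for a
  have "(\<Sum>a\<in>A. l a * a) = (\<Sum>a\<in>A. 2 * (if a \<in> B then a else 0) - a)"
    by (intro sum.cong) (auto simp: l_def)
  also have "\<dots> = 2 * \<Sum>(A \<inter> B) - \<Sum>A"
    by (simp add: sum_subtractf sum.inter_restrict assms flip: sum_distrib_left)
  also have "A \<inter> B = B"
    using B by blast
  finally have "x = (\<Sum>a\<in>A. l a * a)"
    by (simp add: x)
  moreover have "(\<Sum>a\<in>A. \<bar>l a\<bar>) = (\<Sum>a\<in>A. 1)"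
    by (intro sum.cong) (auto simp: l_def)
  moreover have "\<forall>a\<in>A. l a \<in> {-1, 0, 1}"
    by (auto simp: l_def)
  ultimately show "x \<in> restricted_signed_sumset (card A) A"
    unfolding restricted_signed_sumset_def by auto
qed

lemma card_restricted_signed_sumset_card_self:
  assumes "finite A"
  shows "card (restricted_signed_sumset (card A) A) = card (subset_sums A)"
  unfolding restricted_signed_sumset_card_self[OF assms]
  by (intro card_image) (auto simp: inj_on_def)

section \<open>Adding a new maximum\<close>

text \<open>The reflected elements lie above every subset sum of \<open>A\<close>, because \<open>j < b\<close> gives
  \<open>\<Sum>A + b - j > \<Sum>A\<close>.\<close>

lemma subset_sums_insert_max_supset:
  assumes "finite A" "\<forall>a\<in>A. a > 0" "b > 0" "\<forall>a\<in>A. a < b"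
  defines "N \<equiv> (\<lambda>j. \<Sum>A + b - j) ` insert 0 A"
  shows "subset_sums A \<union> N \<subseteq> subset_sums (insert b A)"
    and "card (subset_sums A \<union> N) = card (subset_sums A) + card A + 1"
proof -
  have b: "b \<notin> A" and 0: "0 \<notin> A"
    using assms by auto
  have "j \<in> subset_sums (insert b A)" if "j \<in> insert 0 A" for j
    using that sum_in_subset_sums[of "{}" "insert b A"] sum_in_subset_sums[of "{j}" "insert b A"]
    by auto
  then have "\<Sum>(insert b A) - j \<in> subset_sums (insert b A)" if "j \<in> insert 0 A" for j
    using that assms(1) by (blast intro: subset_sums_reflect)
  then have "(\<lambda>j. \<Sum>(insert b A) - j) ` insert 0 A \<subseteq> subset_sums (insert b A)"
    by blast
  then have "N \<subseteq> subset_sums (insert b A)"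
    using assms(1) b by (simp add: N_def add.commute)
  then show "subset_sums A \<union> N \<subseteq> subset_sums (insert b A)"
    using assms(1) b by (auto simp: subset_sums_insert)
  have "x > \<Sum>A" if "x \<in> N" for x
    using that assms by (auto simp: N_def)
  then have "subset_sums A \<inter> N = {}"
    using subset_sums_le_sum[OF assms(1,2)] by fastforce
  moreover have "card N = card A + 1"
    using assms(1) 0 by (subst N_def, subst card_image) (auto simp: inj_on_def)
  ultimately show "card (subset_sums A \<union> N) = card (subset_sums A) + card A + 1"
    using assms(1) by (subst card_Un_disjoint) (auto simp: N_def finite_subset_sums)
qed

lemma card_subset_sums_ge:
  assumes "finite A" "\<forall>a\<in>A. a > 0"
  shows "card (subset_sums A) \<ge> ((card A + 1) choose 2) + 1"
  using assms
proof (induction A rule: finite_linorder_max_induct)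
  case empty
  then show ?case by (simp add: subset_sums_empty)
next
  case (insert b A)
  have "b \<notin> A"
    using insert.hyps by auto
  have "card (subset_sums A) + card A + 1 \<le> card (subset_sums (insert b A))"
    using subset_sums_insert_max_supset[of A b] insert.hyps insert.prems
    by (metis card_mono finite.insertI finite_subset_sums insertCI)
  moreover have "card (subset_sums A) \<ge> ((card A + 1) choose 2) + 1"
    using insert by simp
  ultimately show ?case
    using insert.hyps \<open>b \<notin> A\<close> by (simp add: numeral_2_eq_2)
qed

definition minimal_subset_sums :: "int set \<Rightarrow> bool" where
  "minimal_subset_sums A \<longleftrightarrow> card (subset_sums A) = ((card A + 1) choose 2) + 1"

text \<open>Minimality leaves no room for subset sums beyond those that
  \<open>subset_sums_insert_max_supset\<close> exhibits. The second conclusion applies this to \<open>\<Sum>A + b - x\<close>,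
  which is \<open>\<Sum>A + b - j\<close> with \<open>j \<in> insert 0 A\<close> only if \<open>x = j\<close>.\<close>

lemma minimal_subset_sums_insert_max:
  assumes "finite A" "\<forall>a\<in>A. a > 0" "b > 0" "\<forall>a\<in>A. a < b"
    and "minimal_subset_sums (insert b A)"
  shows "minimal_subset_sums A"
    and "\<And>x. x \<in> subset_sums A \<Longrightarrow> x \<notin> insert 0 A \<Longrightarrow> \<Sum>A + b - x \<in> subset_sums A"
proof -
  let ?N = "(\<lambda>j. \<Sum>A + b - j) ` insert 0 A"
  note supset = subset_sums_insert_max_supset[OF assms(1-4)]
  have b: "b \<notin> A"
    using assms by auto
  have fin: "finite (subset_sums (insert b A))"
    using assms(1) by (simp add: finite_subset_sums)
  have card: "card (subset_sums (insert b A)) = ((card A + 1) choose 2) + 1 + card A + 1"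
    using assms(1,5) b by (simp add: minimal_subset_sums_def numeral_2_eq_2)
  have "card (subset_sums A) + card A + 1 \<le> card (subset_sums (insert b A))"
    using card_mono[OF fin supset(1)] supset(2) by simp
  then show min: "minimal_subset_sums A"
    using card card_subset_sums_ge[OF assms(1,2)] by (simp add: minimal_subset_sums_def)
  have eq: "subset_sums A \<union> ?N = subset_sums (insert b A)"
    using supset card min by (intro card_subset_eq[OF fin]) (auto simp: minimal_subset_sums_def)
  fix x assume x: "x \<in> subset_sums A" "x \<notin> insert 0 A"
  have "x \<in> subset_sums (insert b A)"
    using x assms(1) b by (simp add: subset_sums_insert)
  then have "\<Sum>A + b - x \<in> subset_sums (insert b A)"
    using subset_sums_reflect[of "insert b A" x] assms(1) b by (simp add: add.commute)
  then show "\<Sum>A + b - x \<in> subset_sums A"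
    using x(2) unfolding eq[symmetric] by auto
qed

section \<open>Sets with the fewest subset sums\<close>

lemma obtain_max:
  fixes A :: "int set"
  assumes "card A = Suc n"
  obtains b A' where "A = insert b A'" "finite A'" "card A' = n" "\<forall>a\<in>A'. a < b"
proof -
  have fin: "finite A" "A \<noteq> {}"
    using assms card.infinite by fastforce+
  show ?thesis
  proof (rule that)
    show "A = insert (Max A) (A - {Max A})"
      using fin by (simp add: insert_absorb)
    show "card (A - {Max A}) = n"
      using fin assms by simp
    show "\<forall>a\<in>A - {Max A}. a < Max A"
      using fin by (auto simp: order.not_eq_order_implies_strict)
  qed (use fin in auto)
qed

lemma minimal_subset_sums_card_3:
  assumes "card A = 3" "\<forall>a\<in>A. a > 0" "minimal_subset_sums A"
  shows "\<exists>p q. 0 < p \<and> p < q \<and> A = {p, q, p + q}"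
proof -
  obtain c A' where A': "A = insert c A'" "finite A'" "card A' = 2" "\<forall>a\<in>A'. a < c"
    using obtain_max[of A 2] assms(1) by auto
  obtain p q where pq: "A' = {p, q}" "p < q"
    using A'(3) by (metis card_2_iff doubleton_eq_iff linorder_neqE)
  have pos: "0 < p" "0 < q" "0 < c"
    using assms(2) A'(1) pq by auto
  have sums: "subset_sums {p, q} = {0, q, p, p + q}"
    using pq(2) by (auto simp: subset_sums_insert subset_sums_empty)
  have "\<Sum>A' + c - (p + q) \<in> subset_sums A'"
    using minimal_subset_sums_insert_max(2)[of A' c "p + q"] assms A' pq pos sums by auto
  then have "c \<in> {0, q, p, p + q}"
    using pq by (simp add: sums)
  then have "c = p + q"
    using A'(4) pq pos by auto
  then show ?thesis
    using A'(1) pq pos by blast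
qed

lemma minimal_subset_sums_card_4:
  assumes "card A = 4" "\<forall>a\<in>A. a > 0" "minimal_subset_sums A"
  shows "\<exists>d>0. A = {d, 2 * d, 3 * d, 4 * d}"
proof -
  obtain c A' where A': "A = insert c A'" "finite A'" "card A' = 3" "\<forall>a\<in>A'. a < c"
    using obtain_max[of A 3] assms(1) by auto
  have "c > 0" and pos': "\<forall>a\<in>A'. a > 0"
    using assms(2) A'(1) by auto
  note min = minimal_subset_sums_insert_max[OF A'(2) pos' \<open>c > 0\<close> A'(4)
      assms(3)[unfolded A'(1)]]
  obtain p q where pq: "0 < p" "p < q" "A' = {p, q, p + q}"
    using minimal_subset_sums_card_3[OF A'(3) pos' min(1)] by blast
  have sums: "subset_sums A' =
      {0, p, q, p + q, 2 * p + q, p + 2 * q, 2 * p + 2 * q}"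
    using pq by (auto simp: subset_sums_insert subset_sums_empty)
  have sum: "\<Sum>A' = 2 * p + 2 * q"
    using pq by simp
  have "q + c \<in> subset_sums A'"
    using min(2)[of "2 * p + q"] pq sum sums by (auto simp: algebra_simps)
  then have c: "c = 2 * p + q"
    unfolding sums using A'(4) pq by auto
  have "p + c \<in> subset_sums A'"
    using min(2)[of "p + 2 * q"] pq sum sums by (auto simp: algebra_simps)
  then have "q = 2 * p"
    unfolding sums using c pq by auto
  then show ?thesis
    using A'(1) pq c by (intro exI[of _ p]) auto
qed

lemma minimal_subset_sums_dilation:
  assumes "k \<ge> 4" "card A = k" "\<forall>a\<in>A. a > 0" "minimal_subset_sums A"
  shows "\<exists>d>0. A = dilation d {1..int k}"
  using assms
proof (induction k arbitrary: A rule: nat_induct_at_least)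
  case base
  have "{1..4} = {1, 2, 3, 4 :: int}"
    by auto
  then have "dilation d {1..int 4} = {d, 2 * d, 3 * d, 4 * d}" for d
    by (auto simp: dilation_def)
  then show ?case
    using minimal_subset_sums_card_4 base by simp
next
  case (Suc n)
  obtain b A' where A': "A = insert b A'" "finite A'" "card A' = n" "\<forall>a\<in>A'. a < b"
    using obtain_max[of A n] Suc.prems(1) by auto
  have "b > 0" and pos': "\<forall>a\<in>A'. a > 0"
    using Suc.prems(2) A'(1) by auto
  note min = minimal_subset_sums_insert_max[OF A'(2) pos' \<open>b > 0\<close> A'(4)
      Suc.prems(3)[unfolded A'(1)]]
  obtain d where d: "d > 0" "A' = dilation d {1..int n}"
    using Suc.IH[OF A'(3) pos' min(1)] by blast
  define x where "x = d * (int n + 1)"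
  have ends: "d \<in> A'" "d * int n \<in> A'"
    using d Suc.hyps by (force simp: dilation_def)+
  \<comment> \<open>The least multiple of \<open>d\<close> above \<open>A'\<close> is a subset sum: least plus greatest element.\<close>
  have "\<Sum>{d, d * int n} = x"
    using d Suc.hyps by (simp add: x_def algebra_simps)
  then have "x \<in> subset_sums A'"
    using ends sum_in_subset_sums[of "{d, d * int n}" A'] by simp
  moreover have "x \<notin> insert 0 A'"
    using d by (auto simp: x_def dilation_def)
  ultimately have new: "\<Sum>A' + b - x \<in> subset_sums A'"
    by (rule min(2))
  have "b \<le> x"
    using subset_sums_le_sum[OF A'(2) pos' new] by simp
  have dvd: "\<forall>a\<in>A'. d dvd a"
    using d by (auto simp: dilation_def)
  have "d dvd \<Sum>A' + (b - x)"
    using subset_sums_dvd[OF dvd new] by (simp add: algebra_simps)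
  moreover have "d dvd \<Sum>A'"
    using dvd by (simp add: dvd_sum)
  ultimately have "d dvd b - x"
    by (simp add: dvd_add_right_iff)
  then have "d dvd (b - x) + x"
    unfolding x_def by (intro dvd_add) simp_all
  then obtain m where m: "b = d * m"
    by auto
  have "d * int n < d * m" "d * m \<le> d * (int n + 1)"
    using A'(4) ends \<open>b \<le> x\<close> m by (auto simp: x_def)
  then have "m = int n + 1"
    using d(1) by (simp add: mult_less_cancel_left mult_le_cancel_left)
  moreover have "{1..int (Suc n)} = insert (int n + 1) {1..int n}"
    by auto
  ultimately have "A = dilation d {1..int (Suc n)}"
    using A'(1) d(2) m by (auto simp: dilation_def)
  then show ?case
    using d(1) by blast
qed

theorem theorem2p3:
  fixes k :: nat and A :: "int set"
  assumes "k \<ge> 3"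
    and "finite A" and "card A = k"
    and "\<forall>a\<in>A. a > 0"
    and "card (restricted_signed_sumset k A) = ((k + 1) choose 2) + 1"
  shows "(k = 3 \<longrightarrow> (\<exists>a0 a1 :: int. 0 < a0 \<and> a0 < a1 \<and> A = {a0, a1, a0 + a1})) \<and>
         (k \<ge> 4 \<longrightarrow> (\<exists>d :: int. d > 0 \<and> A = dilation d {1..int k}))"
proof -
  have "minimal_subset_sums A"
    using assms card_restricted_signed_sumset_card_self[of A]
    by (simp add: minimal_subset_sums_def)
  then show ?thesis
    using assms minimal_subset_sums_card_3 minimal_subset_sums_dilation by blast
qed

end
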